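(* Let $X$ be a countably based topological space which admits a compatible bicomplete quasi-metric. Then a subset $Y\subseteq X$ (with the subspace topology) admits a compatible bicomplete quasi-metric if and only if $Y\in\mathbf{\Pi}^0_3(X)$.
   Context: A quasi-metric on a set $X$ is a function $d\colon X\times X\to[0,\infty)$ with $x=y$ iff $d(x,y)=d(y,x)=0$ and $d(x,z)\le d(x,y)+d(y,z)$; it induces the topology generated by $B_d(x,\varepsilon)=\{y\mid d(x,y)<\varepsilon\}$, and is compatible with a topology if it induces that topology. $(X,d)$ is bicomplete if the metric $\widehat d(x,y)=\max\{d(x,y),d(y,x)\}$ is complete. Borel hierarchy on a topological space $X$: $\mathbf{\Sigma}^0_1(X)$ = open sets; for $1<\alpha<\omega_1$, $\mathbf{\Sigma}^0_\alpha(X)$ consists of sets $\bigcup_{i\in\omega}(B_i\setminus B_i')$ with $B_i,B_i'\in\mathbf{\Sigma}^0_{\beta_i}(X)$, $\beta_i<\alpha$; $\mathbf{\Pi}^0_\alpha(X)$ = complements of $\mathbf{\Sigma}^0_\alpha(X)$ sets. *)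

theory Defs
  imports "HOL-Analysis.Analysis"
begin

definition quasi_metric :: "'a set \<Rightarrow> ('a \<Rightarrow> 'a \<Rightarrow> real) \<Rightarrow> bool" where
  "quasi_metric S d \<longleftrightarrow>
     (\<forall>x\<in>S. \<forall>y\<in>S. 0 \<le> d x y) \<and>
     (\<forall>x\<in>S. \<forall>y\<in>S. x = y \<longleftrightarrow> d x y = 0 \<and> d y x = 0) \<and>
     (\<forall>x\<in>S. \<forall>y\<in>S. \<forall>z\<in>S. d x z \<le> d x y + d y z)"

definition qball :: "'a set \<Rightarrow> ('a \<Rightarrow> 'a \<Rightarrow> real) \<Rightarrow> 'a \<Rightarrow> real \<Rightarrow> 'a set" where
  "qball S d x e = {y \<in> S. d x y < e}"

definition qmetric_topology :: "'a set \<Rightarrow> ('a \<Rightarrow> 'a \<Rightarrow> real) \<Rightarrow> 'a topology" where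
  "qmetric_topology S d = topology_generated_by {qball S d x e | x e. x \<in> S \<and> e > 0}"

definition sym_qmetric :: "('a \<Rightarrow> 'a \<Rightarrow> real) \<Rightarrow> 'a \<Rightarrow> 'a \<Rightarrow> real" where
  "sym_qmetric d x y = max (d x y) (d y x)"

definition bicomplete :: "'a set \<Rightarrow> ('a \<Rightarrow> 'a \<Rightarrow> real) \<Rightarrow> bool" where
  "bicomplete S d \<longleftrightarrow> Metric_space S (sym_qmetric d) \<and> Metric_space.mcomplete S (sym_qmetric d)"

definition admits_bicomplete_quasi_metric :: "'a topology \<Rightarrow> bool" where
  "admits_bicomplete_quasi_metric X \<longleftrightarrow>
     (\<exists>d. quasi_metric (topspace X) d \<and> qmetric_topology (topspace X) d = X \<and>
          bicomplete (topspace X) d)"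

inductive borel_sigma :: "'a topology \<Rightarrow> nat \<Rightarrow> 'a set \<Rightarrow> bool" for X where
  open_sigma: "openin X U \<Longrightarrow> borel_sigma X 1 U"
| union_sigma: "1 < \<alpha> \<Longrightarrow>
    (\<forall>i. 1 \<le> \<beta> i \<and> \<beta> i < \<alpha> \<and> borel_sigma X (\<beta> i) (B i) \<and> borel_sigma X (\<beta> i) (B' i)) \<Longrightarrow>
    borel_sigma X \<alpha> (\<Union>i::nat. B i - B' i)"

definition borel_pi :: "'a topology \<Rightarrow> nat \<Rightarrow> 'a set \<Rightarrow> bool" where
  "borel_pi X \<alpha> A \<longleftrightarrow> (\<exists>B. borel_sigma X \<alpha> B \<and> A = topspace X - B)"

end

theory Submission
  imports Defs
begin

text \<open>
  Let \<open>Y\<close> be the intersection over \<open>n\<close> of the unions over \<open>k\<close> of locally closed sets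
  \<open>U n k - V n k\<close>. Adding to the quasi-metric of \<open>X\<close> terms of the form \<open>1 / f y - 1 / f x\<close>, where
  \<open>f x\<close> is the distance from \<open>x\<close> to the complement of an open set, one may assume that Cauchy
  sequences of the symmetrization eventually decide every \<open>U n k\<close> and \<open>V n k\<close>, in agreement with
  their limits. For fixed \<open>n\<close>, let a step lead from \<open>x\<close> to \<open>y\<close> if \<open>y\<close> lies in all the sets \<open>U n j\<close>
  and \<open>V n j\<close> containing \<open>x\<close> with \<open>j \<le> k\<close>, where \<open>k\<close> is the least index with \<open>x \<in> U n k - V n k\<close>.
  The transitive closure of this relation has open upper sets, and two points reachable from each
  other have the same least index. Adding the corresponding zero-one hemimetrics for all \<open>n\<close>, the
  least indices along a Cauchy sequence become constant, which forces its limit into \<open>Y\<close>.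

  Conversely, the symmetrization of a compatible quasi-metric on a second countable space is
  separable. The points of a bicomplete \<open>Y\<close> are those \<open>x\<close> that lie, for every \<open>n\<close>, in (an
  extension to \<open>X\<close> of) a symmetric \<open>1 / n\<close>-ball around a point of a countable dense set and that
  cannot be separated from \<open>Y\<close> by Boolean combinations of countably many open sets.
\<close>

section \<open>Compatible bicomplete quasi-metrics\<close>

text \<open>Points need not be separated: the terms added later vanish between many distinct points,
  and one separating member is enough for a whole family.\<close>

definition hemimetric :: "'a set \<Rightarrow> ('a \<Rightarrow> 'a \<Rightarrow> real) \<Rightarrow> bool" where
  "hemimetric S d \<longleftrightarrow>
     (\<forall>x\<in>S. \<forall>y\<in>S. 0 \<le> d x y) \<and> (\<forall>x\<in>S. d x x = 0) \<and>
     (\<forall>x\<in>S. \<forall>y\<in>S. \<forall>z\<in>S. d x z \<le> d x y + d y z)"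

text \<open>One direction of \<open>d\<close> suffices, as \<open>m\<close> and \<open>n\<close>
  range independently and may be swapped.\<close>

definition sym_cauchy :: "('a \<Rightarrow> 'a \<Rightarrow> real) \<Rightarrow> (nat \<Rightarrow> 'a) \<Rightarrow> bool" where
  "sym_cauchy d \<sigma> \<longleftrightarrow> (\<forall>e>0. \<exists>N. \<forall>m\<ge>N. \<forall>n\<ge>N. d (\<sigma> m) (\<sigma> n) < e)"

definition sym_converges :: "('a \<Rightarrow> 'a \<Rightarrow> real) \<Rightarrow> (nat \<Rightarrow> 'a) \<Rightarrow> 'a \<Rightarrow> bool" where
  "sym_converges d \<sigma> x \<longleftrightarrow>
     (\<forall>e>0. \<forall>\<^sub>F n in sequentially. d (\<sigma> n) x < e \<and> d x (\<sigma> n) < e)"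

lemma quasi_metric_imp_hemimetric: "quasi_metric S d \<Longrightarrow> hemimetric S d"
  by (auto simp: quasi_metric_def hemimetric_def)

lemma hemimetricD:
  assumes "hemimetric S d"
  shows "\<lbrakk>x \<in> S; y \<in> S\<rbrakk> \<Longrightarrow> 0 \<le> d x y" "x \<in> S \<Longrightarrow> d x x = 0"
    "\<lbrakk>x \<in> S; y \<in> S; z \<in> S\<rbrakk> \<Longrightarrow> d x z \<le> d x y + d y z"
  using assms by (auto simp: hemimetric_def)

text \<open>Balls are by definition only a subbasis; the triangle inequality makes them a base,
  since the ball of radius \<open>e - d a x\<close> about \<open>x\<close> stays inside the ball of
  radius \<open>e\<close> about \<open>a\<close>.\<close>

lemma openin_qmetric_topology:
  assumes "hemimetric S d"
  shows "openin (qmetric_topology S d) U \<longleftrightarrow> U \<subseteq> S \<and> (\<forall>x\<in>U. \<exists>e>0. qball S d x e \<subseteq> U)"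
proof
  assume "openin (qmetric_topology S d) U"
  then have "generate_topology_on {qball S d x e | x e. x \<in> S \<and> e > 0} U"
    by (simp add: qmetric_topology_def openin_topology_generated_by_iff)
  then show "U \<subseteq> S \<and> (\<forall>x\<in>U. \<exists>e>0. qball S d x e \<subseteq> U)"
  proof induction
    case Empty
    then show ?case by simp
  next
    case (Int a b)
    have "\<exists>e>0. qball S d x e \<subseteq> a \<inter> b" if "x \<in> a \<inter> b" for x
    proof -
      have "x \<in> a" "x \<in> b" using that by auto
      then obtain e f where "e > 0" "qball S d x e \<subseteq> a" "f > 0" "qball S d x f \<subseteq> b"
        using Int.IH by meson
      then show ?thesis
        by (intro exI[of _ "min e f"]) (auto simp: qball_def)
    qed
    then show ?case using Int.IH by blast
  next
    case (UN K)
    show ?case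
    proof (intro conjI ballI)
      show "\<Union>K \<subseteq> S" using UN.IH by blast
    next
      fix x assume "x \<in> \<Union>K"
      then obtain k where k: "k \<in> K" "x \<in> k" by blast
      then obtain e where "e > 0" "qball S d x e \<subseteq> k" using UN.IH by meson
      then show "\<exists>e>0. qball S d x e \<subseteq> \<Union>K" using k by blast
    qed
  next
    case (Basis s)
    then obtain a e where s: "s = qball S d a e" "a \<in> S" "e > 0" by blast
    have "\<exists>r>0. qball S d x r \<subseteq> s" if "x \<in> s" for x
    proof (intro exI conjI)
      have x: "x \<in> S" "d a x < e" using that s by (auto simp: qball_def)
      then show "e - d a x > 0" by simp
      have "d a y < e" if "y \<in> S" "d x y < e - d a x" for y
        using hemimetricD(3)[OF assms, of a x y] that s x by linarith
      then show "qball S d x (e - d a x) \<subseteq> s" by (auto simp: qball_def s)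
    qed
    moreover have "s \<subseteq> S" by (auto simp: s qball_def)
    ultimately show ?case by blast
  qed
next
  assume U: "U \<subseteq> S \<and> (\<forall>x\<in>U. \<exists>e>0. qball S d x e \<subseteq> U)"
  show "openin (qmetric_topology S d) U"
  proof (subst openin_subopen, intro ballI)
    fix x assume "x \<in> U"
    then obtain e where e: "e > 0" "qball S d x e \<subseteq> U" using U by blast
    have "x \<in> S" using U \<open>x \<in> U\<close> by blast
    then have "openin (qmetric_topology S d) (qball S d x e)"
      using e unfolding qmetric_topology_def by (intro topology_generated_by_Basis) blast
    moreover have "x \<in> qball S d x e"
      using \<open>x \<in> S\<close> e hemimetricD(2)[OF assms, of x] by (simp add: qball_def)
    ultimately show "\<exists>T. openin (qmetric_topology S d) T \<and> x \<in> T \<and> T \<subseteq> U" using e by blast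
  qed
qed

lemma openin_qball:
  assumes "hemimetric (topspace X) d" "qmetric_topology (topspace X) d = X"
    and "x \<in> topspace X" "e > 0"
  shows "openin X (qball (topspace X) d x e)"
proof -
  have "openin (qmetric_topology (topspace X) d) (qball (topspace X) d x e)"
    using assms(3,4) unfolding qmetric_topology_def by (intro topology_generated_by_Basis) blast
  then show ?thesis using assms(2) by simp
qed

text \<open>The two conjuncts say that the topology of \<open>d\<close> is coarser, respectively
  finer, than that of \<open>X\<close>. In a combined family every member must satisfy the first,
  but only one the second.\<close>

lemma qmetric_topology_eq_iff:
  assumes "hemimetric (topspace X) d"
  shows "qmetric_topology (topspace X) d = X \<longleftrightarrow>
    (\<forall>x\<in>topspace X. \<forall>e>0. \<exists>U. openin X U \<and> x \<in> U \<and> U \<subseteq> qball (topspace X) d x e) \<and>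
    (\<forall>U x. openin X U \<longrightarrow> x \<in> U \<longrightarrow> (\<exists>e>0. qball (topspace X) d x e \<subseteq> U))"
    (is "?eq \<longleftrightarrow> ?nbh \<and> ?base")
proof
  assume eq: ?eq
  have op: "openin X U \<longleftrightarrow>
      U \<subseteq> topspace X \<and> (\<forall>x\<in>U. \<exists>e>0. qball (topspace X) d x e \<subseteq> U)" for U
    using openin_qmetric_topology[OF assms] eq by simp
  have "?nbh"
  proof (intro ballI allI impI exI conjI)
    fix x and e :: real assume x: "x \<in> topspace X" "e > 0"
    show "openin X (qball (topspace X) d x e)" using openin_qball[OF assms eq x] .
    show "x \<in> qball (topspace X) d x e"
      using x hemimetricD(2)[OF assms, of x] by (simp add: qball_def)
  qed simp
  moreover have "?base" using op by meson
  ultimately show "?nbh \<and> ?base" by (rule conjI)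
next
  assume r: "?nbh \<and> ?base"
  show ?eq
    unfolding topology_eq openin_qmetric_topology[OF assms]
  proof (intro allI iffI)
    fix U assume U: "U \<subseteq> topspace X \<and> (\<forall>x\<in>U. \<exists>e>0. qball (topspace X) d x e \<subseteq> U)"
    show "openin X U"
    proof (subst openin_subopen, intro ballI)
      fix x assume x: "x \<in> U"
      then obtain e where e: "e > 0" "qball (topspace X) d x e \<subseteq> U" using U by meson
      have "x \<in> topspace X" using U x by blast
      then obtain T where "openin X T" "x \<in> T" "T \<subseteq> qball (topspace X) d x e"
        using r e(1) by meson
      then show "\<exists>T. openin X T \<and> x \<in> T \<and> T \<subseteq> U" using e(2) by blast
    qed
  next
    fix U assume "openin X U"
    then show "U \<subseteq> topspace X \<and> (\<forall>x\<in>U. \<exists>e>0. qball (topspace X) d x e \<subseteq> U)"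
      using r openin_subset by meson
  qed
qed

text \<open>Nonnegativity is assumed at all points because \<open>Metric_space\<close> asks for it
  outside the carrier, too.\<close>

lemma Metric_space_sym_qmetric:
  assumes "quasi_metric S d" and "\<And>x y. 0 \<le> d x y"
  shows "Metric_space S (sym_qmetric d)"
proof
  fix x y z assume "x \<in> S" "y \<in> S" "z \<in> S"
  then have "d x z \<le> d x y + d y z" "d z x \<le> d z y + d y x"
    using assms(1) by (auto simp: quasi_metric_def)
  then show "sym_qmetric d x z \<le> sym_qmetric d x y + sym_qmetric d y z"
    by (auto simp: sym_qmetric_def max_def)
next
  fix x y assume "x \<in> S" "y \<in> S"
  then have "x = y \<longleftrightarrow> d x y = 0 \<and> d y x = 0" using assms(1) by (auto simp: quasi_metric_def)
  then show "sym_qmetric d x y = 0 \<longleftrightarrow> x = y"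
    using assms(2)[of x y] assms(2)[of y x] by (auto simp: sym_qmetric_def max_def)
qed (use assms(2) in \<open>auto simp: sym_qmetric_def le_max_iff_disj\<close>)

lemma bicomplete_iff:
  "bicomplete S d \<longleftrightarrow> Metric_space S (sym_qmetric d) \<and>
     (\<forall>\<sigma>. range \<sigma> \<subseteq> S \<longrightarrow> sym_cauchy d \<sigma> \<longrightarrow> (\<exists>x\<in>S. sym_converges d \<sigma> x))"
proof (cases "Metric_space S (sym_qmetric d)")
  case True
  then interpret Metric_space S "sym_qmetric d" .
  have cauchy: "MCauchy \<sigma> \<longleftrightarrow> range \<sigma> \<subseteq> S \<and> sym_cauchy d \<sigma>" for \<sigma>
  proof -
    have "(\<forall>n n'. N \<le> n \<longrightarrow> N \<le> n' \<longrightarrow> max (d (\<sigma> n) (\<sigma> n')) (d (\<sigma> n') (\<sigma> n)) < e) \<longleftrightarrow>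
        (\<forall>m\<ge>N. \<forall>n\<ge>N. d (\<sigma> m) (\<sigma> n) < e)" for N e
      by auto
    then show ?thesis by (simp add: MCauchy_def sym_cauchy_def sym_qmetric_def)
  qed
  have limit: "limitin mtopology \<sigma> x sequentially \<longleftrightarrow> x \<in> S \<and> sym_converges d \<sigma> x"
    if "range \<sigma> \<subseteq> S" for \<sigma> x
  proof -
    have "\<sigma> n \<in> S" for n using that by auto
    then show ?thesis by (simp add: limitin_metric sym_converges_def sym_qmetric_def)
  qed
  have "mcomplete \<longleftrightarrow>
      (\<forall>\<sigma>. range \<sigma> \<subseteq> S \<longrightarrow> sym_cauchy d \<sigma> \<longrightarrow> (\<exists>x\<in>S. sym_converges d \<sigma> x))"
    unfolding mcomplete_def cauchy by (simp add: limit Bex_def imp_conjL cong: conj_cong imp_cong)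
  then show ?thesis using True by (simp add: bicomplete_def)
qed (simp add: bicomplete_def)

text \<open>Take the supremum of the \<open>e n\<close> truncated at \<open>(1/2)^n\<close>. The
  truncation makes all but finitely many terms small, so balls of the supremum are neighbourhoods;
  conversely, a value below \<open>(1/2)^n\<close> bounds \<open>e n\<close>. Limits are required
  only for sequences that are Cauchy for all \<open>e n\<close> at once.\<close>

lemma combine_hemimetrics:
  fixes e :: "nat \<Rightarrow> 'a \<Rightarrow> 'a \<Rightarrow> real"
  assumes hm: "\<And>n. hemimetric (topspace X) (e n)"
    and nbh: "\<And>n x r. \<lbrakk>x \<in> topspace X; r > 0\<rbrakk> \<Longrightarrow>
           \<exists>U. openin X U \<and> x \<in> U \<and> U \<subseteq> qball (topspace X) (e n) x r"
    and base: "\<And>U x. \<lbrakk>openin X U; x \<in> U\<rbrakk> \<Longrightarrow> \<exists>r>0. qball (topspace X) (e 0) x r \<subseteq> U"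
    and sep: "\<And>x y. \<lbrakk>x \<in> topspace X; y \<in> topspace X; e 0 x y = 0; e 0 y x = 0\<rbrakk> \<Longrightarrow> x = y"
    and compl: "\<And>\<sigma>. \<lbrakk>range \<sigma> \<subseteq> topspace X; \<And>n. sym_cauchy (e n) \<sigma>\<rbrakk> \<Longrightarrow>
           \<exists>x\<in>topspace X. \<forall>n. sym_converges (e n) \<sigma> x"
  obtains D where "quasi_metric (topspace X) D" "qmetric_topology (topspace X) D = X"
    "bicomplete (topspace X) D"
    "\<And>n x y. \<lbrakk>x \<in> topspace X; y \<in> topspace X; D x y < (1/2)^n\<rbrakk> \<Longrightarrow> e n x y \<le> D x y"
proof -
  let ?S = "topspace X"
  define D where "D x y = (if x \<in> ?S \<and> y \<in> ?S then SUP n. min (e n x y) ((1/2)^n) else 0)" for x y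
  have pos: "0 \<le> e n x y" and tri: "z \<in> ?S \<Longrightarrow> e n x z \<le> e n x y + e n y z"
    if "x \<in> ?S" "y \<in> ?S" for n x y z
    using hemimetricD[OF hm] that by auto
  have bdd: "bdd_above (range (\<lambda>n. min (e n x y) ((1/2)^n)))" for x y
    by (rule bdd_aboveI[of _ 1]) (auto simp: min_le_iff_disj power_le_one)
  have D_ge: "min (e n x y) ((1/2)^n) \<le> D x y" if "x \<in> ?S" "y \<in> ?S" for n x y
    using that cSUP_upper[OF UNIV_I[of n] bdd[of x y]] by (simp add: D_def)
  have D_le: "D x y \<le> c" if "x \<in> ?S" "y \<in> ?S" "\<And>n. min (e n x y) ((1/2)^n) \<le> c" for x y c
    using that cSUP_least[of UNIV "\<lambda>n. min (e n x y) ((1/2)^n)" c] by (simp add: D_def)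
  have D_pos: "0 \<le> D x y" for x y
  proof (cases "x \<in> ?S \<and> y \<in> ?S")
    case True
    then show ?thesis using D_ge[of x y 0] pos[of x y 0] by (auto simp: min_def split: if_splits)
  qed (auto simp: D_def)
  have control: "e n x y \<le> D x y" if "x \<in> ?S" "y \<in> ?S" "D x y < (1/2)^n" for n x y
    using D_ge[OF that(1,2), of n] that(3) by (auto simp: min_def split: if_splits)
  have small: "\<exists>N. \<forall>x\<in>?S. \<forall>y\<in>?S. (\<forall>n<N. e n x y < r) \<longrightarrow> D x y < r" if r: "r > 0" for r
  proof -
    obtain N where N: "(1/2)^N < r/2"
      using real_arch_pow_inv[of "r/2" "1/2"] r by auto
    have "D x y < r" if xy: "x \<in> ?S" "y \<in> ?S" "\<forall>n<N. e n x y < r" for x y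
    proof -
      \<comment> \<open>A finite maximum stays strictly below \<open>r\<close>, whereas a supremum
        of terms below \<open>r\<close> could equal \<open>r\<close>; the entry \<open>r/2\<close>
        covers the tail.\<close>
      define c where "c = Max (insert (r/2) ((\<lambda>n. e n x y) ` {..<N}))"
      have "min (e n x y) ((1/2)^n) \<le> c" for n
      proof (cases "n < N")
        case True
        then have "e n x y \<le> c" by (simp add: c_def)
        then show ?thesis by linarith
      next
        case False
        then have "(1/2::real)^n \<le> (1/2)^N" by (intro power_decreasing) auto
        moreover have "r/2 \<le> c" unfolding c_def by (rule Max_ge) auto
        ultimately show ?thesis using N by linarith
      qed
      then have "D x y \<le> c" using D_le xy by blast
      also have "c < r" using xy r by (simp add: c_def)
      finally show ?thesis .
    qed
    then show ?thesis by blast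
  qed
  have D0: "D x x = 0" if "x \<in> ?S" for x
  proof (rule antisym)
    show "D x x \<le> 0"
      by (rule D_le) (use that hemimetricD(2)[OF hm] in auto)
  qed (rule D_pos)
  have D_tri: "D x z \<le> D x y + D y z" if "x \<in> ?S" "y \<in> ?S" "z \<in> ?S" for x y z
  proof (rule D_le)
    fix n
    have "min a p \<le> min b p + min c p"
      if "a \<le> b + c" "0 \<le> b" "0 \<le> c" "0 \<le> p" for a b c p :: real
      using that by (auto simp: min_def)
    from this[OF tri pos pos]
    have "min (e n x z) ((1/2)^n) \<le> min (e n x y) ((1/2)^n) + min (e n y z) ((1/2)^n)"
      using that by simp
    then show "min (e n x z) ((1/2)^n) \<le> D x y + D y z"
      using D_ge[of x y n] D_ge[of y z n] that by linarith
  qed (use that in auto)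
  have qm: "quasi_metric ?S D"
    unfolding quasi_metric_def
  proof (intro conjI ballI iffI)
    fix x y assume xy: "x \<in> ?S" "y \<in> ?S" "D x y = 0 \<and> D y x = 0"
    then have "e 0 x y = 0" "e 0 y x = 0"
      using control[of x y 0] control[of y x 0] pos[of x y 0] pos[of y x 0] by auto
    then show "x = y" using sep xy by blast
  qed (use D_pos D0 D_tri in auto)
  have hmD: "hemimetric ?S D" using qm by (rule quasi_metric_imp_hemimetric)
  have top: "qmetric_topology ?S D = X"
    unfolding qmetric_topology_eq_iff[OF hmD]
  proof (intro conjI ballI allI impI)
    fix x and r :: real assume x: "x \<in> ?S" and r: "r > 0"
    obtain N where N: "\<And>y. \<lbrakk>y \<in> ?S; \<forall>n<N. e n x y < r\<rbrakk> \<Longrightarrow> D x y < r"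
      using small[OF r] x by blast
    obtain U where U: "\<And>n. openin X (U n) \<and> x \<in> U n \<and> U n \<subseteq> qball ?S (e n) x r"
      using nbh[OF x r] by metis
    have "openin X ((\<Inter>n\<in>{..<N}. U n) \<inter> ?S)" using U by (intro openin_INT) auto
    moreover have "(\<Inter>n\<in>{..<N}. U n) \<inter> ?S \<subseteq> qball ?S D x r"
      using U N by (fastforce simp: qball_def)
    ultimately show "\<exists>U. openin X U \<and> x \<in> U \<and> U \<subseteq> qball ?S D x r" using U x by blast
  next
    fix U x assume U: "openin X U" "x \<in> U"
    then obtain r where r: "r > 0" "qball ?S (e 0) x r \<subseteq> U" using base by blast
    have "x \<in> ?S" using U openin_subset by blast
    \<comment> \<open>The bound 1 is \<open>(1/2)^0\<close>, below which \<open>D\<close> dominates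
      \<open>e 0\<close>.\<close>
    then have "qball ?S D x (min r 1) \<subseteq> qball ?S (e 0) x r"
      using control[of x _ 0] by (force simp: qball_def)
    then show "\<exists>r>0. qball ?S D x r \<subseteq> U" using r by (intro exI[of _ "min r 1"]) auto
  qed
  have "\<exists>x\<in>?S. sym_converges D \<sigma> x" if \<sigma>: "range \<sigma> \<subseteq> ?S" "sym_cauchy D \<sigma>" for \<sigma>
  proof -
    have \<sigma>S: "\<sigma> n \<in> ?S" for n using \<sigma> by auto
    have "sym_cauchy (e n) \<sigma>" for n
      unfolding sym_cauchy_def
    proof (intro allI impI)
      fix r :: real assume "r > 0"
      then obtain N where N: "\<forall>i\<ge>N. \<forall>j\<ge>N. D (\<sigma> i) (\<sigma> j) < min r ((1/2)^n)"
        using \<sigma>(2) unfolding sym_cauchy_def by (meson min_less_iff_conj zero_less_divide_1_iff zero_less_numeral zero_less_power)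
      then have "e n (\<sigma> i) (\<sigma> j) < r" if "i \<ge> N" "j \<ge> N" for i j
        using control[OF \<sigma>S \<sigma>S, of i j n] that by fastforce
      then show "\<exists>N. \<forall>i\<ge>N. \<forall>j\<ge>N. e n (\<sigma> i) (\<sigma> j) < r" by blast
    qed
    then obtain x where x: "x \<in> ?S" "\<And>n. sym_converges (e n) \<sigma> x" using compl \<sigma>(1) by blast
    have "sym_converges D \<sigma> x"
      unfolding sym_converges_def
    proof (intro allI impI)
      fix r :: real assume "r > 0"
      then obtain N where N: "\<And>x y. \<lbrakk>x \<in> ?S; y \<in> ?S; \<forall>n<N. e n x y < r\<rbrakk> \<Longrightarrow> D x y < r"
        using small by meson
      have "\<forall>\<^sub>F i in sequentially. \<forall>n\<in>{..<N}. e n (\<sigma> i) x < r \<and> e n x (\<sigma> i) < r"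
        using x(2) \<open>r > 0\<close> by (intro eventually_ball_finite) (auto simp: sym_converges_def)
      then show "\<forall>\<^sub>F i in sequentially. D (\<sigma> i) x < r \<and> D x (\<sigma> i) < r"
        by eventually_elim (use N x(1) \<sigma>S in auto)
    qed
    then show ?thesis using x by blast
  qed
  then have "bicomplete ?S D"
    using Metric_space_sym_qmetric[OF qm D_pos] by (auto simp: bicomplete_iff)
  then show ?thesis using that qm top control by blast
qed

section \<open>Making open sets clopen for the symmetrization\<close>

text \<open>\<open>f\<close> is the distance to the complement of \<open>U\<close>, capped at 1 so
  that it makes sense for \<open>U = S\<close>. The first property is the triangle inequality;
  positivity holds because a ball about each point of \<open>U\<close> avoids the
  complement.\<close>

lemma gap_function_exists:
  assumes hm: "hemimetric S d" and U: "U \<subseteq> S" "\<And>x. x \<in> U \<Longrightarrow> \<exists>e>0. qball S d x e \<subseteq> U"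
  obtains f :: "'a \<Rightarrow> real" where
    "\<And>x y. \<lbrakk>x \<in> S; y \<in> S\<rbrakk> \<Longrightarrow> f x \<le> d x y + f y"
    "\<And>x. x \<in> U \<Longrightarrow> 0 < f x" "\<And>x. x \<in> S - U \<Longrightarrow> f x = 0"
proof -
  define f where "f x = Inf (insert 1 (d x ` (S - U)))" for x
  have bdd: "bdd_below (insert 1 (d x ` (S - U)))" if "x \<in> S" for x
    by (rule bdd_belowI[of _ 0]) (use hemimetricD(1)[OF hm] that in auto)
  have ge: "c \<le> f x" if "c \<le> 1" "\<And>y. y \<in> S - U \<Longrightarrow> c \<le> d x y" for x c
    unfolding f_def using that by (intro cInf_greatest) auto
  have le1: "f x \<le> 1" and le: "y \<in> S - U \<Longrightarrow> f x \<le> d x y" if "x \<in> S" for x y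
    unfolding f_def using bdd[OF that] by (auto intro!: cInf_lower)
  show ?thesis
  proof
    fix x y assume xy: "x \<in> S" "y \<in> S"
    have "f x - d x y \<le> f y"
    proof (rule ge)
      show "f x - d x y \<le> 1" using le1[of x] hemimetricD(1)[OF hm, of x y] xy by simp
      show "f x - d x y \<le> d y z" if "z \<in> S - U" for z
        using le[of x z] hemimetricD(3)[OF hm, of x y z] xy that by simp
    qed
    then show "f x \<le> d x y + f y" by simp
  next
    fix x assume "x \<in> U"
    then obtain e where e: "e > 0" "qball S d x e \<subseteq> U" using U by blast
    have "min e 1 \<le> f x"
      by (rule ge) (use e in \<open>auto simp: qball_def min_le_iff_disj not_less[symmetric]\<close>)
    then show "0 < f x" using e by linarith
  next
    fix x assume x: "x \<in> S - U"
    then have "f x \<le> 0" using le[of x x] hemimetricD(2)[OF hm, of x] by simp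
    moreover have "0 \<le> f x" by (rule ge) (use x hemimetricD(1)[OF hm] in auto)
    ultimately show "f x = 0" by simp
  qed
qed

text \<open>
  With \<open>f\<close> a gap function of \<open>U\<close>, a Cauchy sequence for \<open>cut_hemimetric U f\<close> that stays in \<open>U\<close>
  keeps \<open>1 / f\<close> bounded, so it cannot escape to the boundary of \<open>U\<close>.
\<close>
definition cut_hemimetric :: "'a set \<Rightarrow> ('a \<Rightarrow> real) \<Rightarrow> 'a \<Rightarrow> 'a \<Rightarrow> real" where
  "cut_hemimetric U f x y =
     (if x \<in> U then if y \<in> U then min 1 (max 0 (1 / f y - 1 / f x)) else 1 else 0)"

text \<open>The truncation at 1 saves the triangle inequality for a detour that leaves
  \<open>U\<close> and returns: the exit already costs 1.\<close>

lemma hemimetric_cut_hemimetric: "hemimetric S (cut_hemimetric U f)"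
  unfolding hemimetric_def cut_hemimetric_def by auto

text \<open>Near \<open>x\<close> the function \<open>f\<close> is bounded from below, hence
  \<open>1 / f\<close> from above; the positive part in \<open>cut_hemimetric\<close> measures just
  this one-sided change.\<close>

lemma cut_hemimetric_nbhd:
  assumes hm: "hemimetric S d" and U: "U \<subseteq> S"
    and f: "\<And>x y. \<lbrakk>x \<in> S; y \<in> S\<rbrakk> \<Longrightarrow> f x \<le> d x y + f y"
      "\<And>x. x \<in> U \<Longrightarrow> 0 < f x" "\<And>x. x \<in> S - U \<Longrightarrow> f x = 0"
    and x: "x \<in> S" and r: "r > 0"
  shows "\<exists>e>0. qball S d x e \<subseteq> qball S (cut_hemimetric U f) x r"
proof (cases "x \<in> U")
  case False
  then show ?thesis
    using r by (intro exI[of _ 1]) (auto simp: qball_def cut_hemimetric_def)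
next
  case True
  \<comment> \<open>Chosen so that \<open>f y > c\<close> amounts to
    \<open>1 / f y < 1 / f x + r\<close>.\<close>
  define c where "c = 1 / (1 / f x + r)"
  have fx: "f x > 0" using f(2) True by blast
  then have "1 / f x > 0" by simp
  then have "1 / f x + r > 0" using r by linarith
  then have inv: "1 / c = 1 / f x + r" and "c > 0" by (simp_all add: c_def)
  have "1 / f x < 1 / c" using inv r by simp
  then have "c < f x" using fx \<open>c > 0\<close> by (simp add: field_simps)
  have "cut_hemimetric U f x y < r" if y: "y \<in> S" "d x y < f x - c" for y
  proof -
    have "c < f y" using f(1)[OF x y(1)] y(2) by linarith
    then have "y \<in> U" using f(3)[of y] y(1) \<open>c > 0\<close> by fastforce
    have "1 / f y < 1 / c" using \<open>c < f y\<close> \<open>c > 0\<close> by (simp add: frac_less2)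
    then show ?thesis using True \<open>y \<in> U\<close> r inv by (simp add: cut_hemimetric_def min_less_iff_disj)
  qed
  then show ?thesis
    using \<open>c < f x\<close> by (intro exI[of _ "f x - c"]) (auto simp: qball_def)
qed

text \<open>A tail of the sequence lies on one side of \<open>U\<close>. If outside, so does the
  limit, as \<open>U\<close> is open; if inside, the bound on \<open>1 / f\<close> keeps
  \<open>f\<close> away from zero, also at the limit.\<close>

lemma cut_hemimetric_converges:
  assumes U: "U \<subseteq> S" "\<And>x. x \<in> U \<Longrightarrow> \<exists>e>0. qball S d x e \<subseteq> U"
    and f: "\<And>x y. \<lbrakk>x \<in> S; y \<in> S\<rbrakk> \<Longrightarrow> f x \<le> d x y + f y"
      "\<And>x. x \<in> U \<Longrightarrow> 0 < f x" "\<And>x. x \<in> S - U \<Longrightarrow> f x = 0"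
    and x: "x \<in> S" "sym_converges d \<sigma> x"
    and \<sigma>: "range \<sigma> \<subseteq> S" "sym_cauchy (cut_hemimetric U f) \<sigma>"
  shows "sym_converges (cut_hemimetric U f) \<sigma> x"
proof -
  have \<sigma>S: "\<sigma> n \<in> S" for n using \<sigma> by auto
  have lim: "(\<lambda>n. f (\<sigma> n)) \<longlonglongrightarrow> f x"
  proof (rule tendstoI)
    fix e :: real assume "e > 0"
    then have "\<forall>\<^sub>F n in sequentially. d (\<sigma> n) x < e \<and> d x (\<sigma> n) < e"
      using x(2) by (simp add: sym_converges_def)
    then show "\<forall>\<^sub>F n in sequentially. dist (f (\<sigma> n)) (f x) < e"
    proof eventually_elim
      case (elim n)
      then show ?case
        using f(1)[OF \<sigma>S x(1), of n] f(1)[OF x(1) \<sigma>S, of n] unfolding dist_real_def by linarith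
    qed
  qed
  \<comment> \<open>Leaving \<open>U\<close> costs 1, so from \<open>N\<close> on the sequence stays
    on one side of \<open>U\<close>.\<close>
  obtain N where N: "\<And>m n. \<lbrakk>m \<ge> N; n \<ge> N\<rbrakk> \<Longrightarrow> cut_hemimetric U f (\<sigma> m) (\<sigma> n) < 1"
    using \<sigma>(2) unfolding sym_cauchy_def by (meson zero_less_one)
  show ?thesis
  proof (cases "\<sigma> N \<in> U")
    case False
    have out: "\<sigma> n \<notin> U" if "n \<ge> N" for n
      using N[OF that order_refl] False by (auto simp: cut_hemimetric_def split: if_splits)
    have "x \<notin> U"
    proof
      assume "x \<in> U"
      then obtain e where e: "e > 0" "qball S d x e \<subseteq> U" using U by blast
      then have "\<forall>\<^sub>F n in sequentially. d (\<sigma> n) x < e \<and> d x (\<sigma> n) < e"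
        using x(2) by (simp add: sym_converges_def)
      then have "\<forall>\<^sub>F n in sequentially. \<sigma> n \<in> U"
        by eventually_elim (use e \<sigma>S in \<open>auto simp: qball_def\<close>)
      moreover have "\<forall>\<^sub>F n in sequentially. \<sigma> n \<notin> U"
        using out by (auto simp: eventually_sequentially)
      ultimately have "\<forall>\<^sub>F n::nat in sequentially. False" by eventually_elim simp
      then show False by simp
    qed
    then show ?thesis
      using out by (auto simp: sym_converges_def cut_hemimetric_def eventually_sequentially)
  next
    case True
    have inU: "\<sigma> n \<in> U" if "n \<ge> N" for n
      using N[OF order_refl that] True by (auto simp: cut_hemimetric_def split: if_splits)
    define c where "c = 1 / (1 / f (\<sigma> N) + 1)"
    have "1 / f (\<sigma> N) > 0" using f(2)[OF True] by simp
    then have "1 / f (\<sigma> N) + 1 > 0" by linarith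
    then have "c > 0" and inv: "1 / c = 1 / f (\<sigma> N) + 1" by (simp_all add: c_def)
    have "c \<le> f (\<sigma> n)" if "n \<ge> N" for n
    proof -
      have "1 / f (\<sigma> n) < 1 / c"
        using N[OF order_refl that] True inU[OF that] inv
        by (simp add: cut_hemimetric_def min_less_iff_disj)
      then show ?thesis using f(2)[OF inU[OF that]] \<open>c > 0\<close> by (simp add: field_simps)
    qed
    then have "c \<le> f x" by (intro LIMSEQ_le_const[OF lim]) blast
    then have "f x > 0" using \<open>c > 0\<close> by linarith
    then have "x \<in> U" using f(3) x(1) by fastforce
    have inv_lim: "(\<lambda>n. 1 / f (\<sigma> n)) \<longlonglongrightarrow> 1 / f x"
      using \<open>f x > 0\<close> by (intro tendsto_intros lim) auto
    have "\<forall>\<^sub>F n in sequentially. \<bar>1 / f (\<sigma> n) - 1 / f x\<bar> < e" if "e > 0" for e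
      using tendstoD[OF inv_lim that] by (simp add: dist_real_def)
    moreover have "\<forall>\<^sub>F n in sequentially. \<sigma> n \<in> U"
      using inU by (auto simp: eventually_sequentially)
    ultimately have ev: "\<forall>\<^sub>F n in sequentially. \<bar>1 / f (\<sigma> n) - 1 / f x\<bar> < e \<and> \<sigma> n \<in> U"
      if "e > 0" for e
      using that by (simp add: eventually_conj)
    have "\<forall>\<^sub>F n in sequentially. cut_hemimetric U f (\<sigma> n) x < e \<and> cut_hemimetric U f x (\<sigma> n) < e"
      if "e > 0" for e
      using ev[OF that]
    proof eventually_elim
      case (elim n)
      then show ?case
        using that \<open>x \<in> U\<close> by (simp add: cut_hemimetric_def min_less_iff_disj abs_less_iff)
    qed
    then show ?thesis by (simp add: sym_converges_def)
  qed
qed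

text \<open>The gap \<open>r\<close> makes each \<open>W n\<close> closed as well as open for the
  symmetrization of \<open>D\<close>. It comes from adding one cut hemimetric for each
  \<open>W n\<close>.\<close>

lemma isolate_open_sets:
  fixes W :: "nat \<Rightarrow> 'a set"
  assumes "admits_bicomplete_quasi_metric X" and W: "\<And>n. openin X (W n)"
  obtains D where "quasi_metric (topspace X) D" "qmetric_topology (topspace X) D = X"
    "bicomplete (topspace X) D"
    "\<And>n. \<exists>r>0. \<forall>x\<in>W n. \<forall>y\<in>topspace X - W n. r \<le> D x y"
proof -
  let ?S = "topspace X"
  obtain d where qm: "quasi_metric ?S d" and top: "qmetric_topology ?S d = X"
    and bi: "bicomplete ?S d"
    using assms(1) by (auto simp: admits_bicomplete_quasi_metric_def)
  have hm: "hemimetric ?S d" using qm by (rule quasi_metric_imp_hemimetric)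
  note op = openin_qmetric_topology[OF hm, unfolded top]
  have WS: "W n \<subseteq> ?S" and Wb: "x \<in> W n \<Longrightarrow> \<exists>e>0. qball ?S d x e \<subseteq> W n" for n x
    using op W by blast+
  have "\<exists>f. (\<forall>x\<in>?S. \<forall>y\<in>?S. f x \<le> d x y + f y) \<and> (\<forall>x\<in>W n. 0 < f x) \<and> (\<forall>x\<in>?S - W n. f x = 0)" for n
    by (rule gap_function_exists[OF hm WS Wb, of n]) blast+
  then obtain f where f: "\<And>n x y. \<lbrakk>x \<in> ?S; y \<in> ?S\<rbrakk> \<Longrightarrow> f n x \<le> d x y + f n y"
      "\<And>n x. x \<in> W n \<Longrightarrow> 0 < f n x" "\<And>n x. x \<in> ?S - W n \<Longrightarrow> f n x = 0"
    by metis
  define e where "e n = (case n of 0 \<Rightarrow> d | Suc m \<Rightarrow> cut_hemimetric (W m) (f m))" for n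
  have e_simps: "e 0 = d" "e (Suc m) = cut_hemimetric (W m) (f m)" for m
    by (simp_all add: e_def)
  obtain D where D: "quasi_metric ?S D" "qmetric_topology ?S D = X" "bicomplete ?S D"
    and control: "\<And>n x y. \<lbrakk>x \<in> ?S; y \<in> ?S; D x y < (1/2)^n\<rbrakk> \<Longrightarrow> e n x y \<le> D x y"
  proof (rule combine_hemimetrics[of X e])
    show "hemimetric ?S (e n)" for n
      by (cases n) (simp_all add: e_simps hm hemimetric_cut_hemimetric)
  next
    fix n x and r :: real assume x: "x \<in> ?S" and r: "r > 0"
    obtain s where "s > 0" "qball ?S d x s \<subseteq> qball ?S (e n) x r"
    proof (cases n)
      case 0
      then show ?thesis using that r by (auto simp: e_simps)
    next
      case (Suc m)
      then show ?thesis
        using that cut_hemimetric_nbhd[OF hm WS f x r, of m] by (auto simp: e_simps)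
    qed
    moreover have "x \<in> qball ?S d x s" if "s > 0" for s
      using hemimetricD(2)[OF hm x] x that by (simp add: qball_def)
    ultimately show "\<exists>U. openin X U \<and> x \<in> U \<and> U \<subseteq> qball ?S (e n) x r"
      using openin_qball[OF hm top x] by blast
  next
    show "\<exists>r>0. qball ?S (e 0) x r \<subseteq> U" if "openin X U" "x \<in> U" for U x
      using op that by (auto simp: e_simps)
  next
    show "x = y" if "x \<in> ?S" "y \<in> ?S" "e 0 x y = 0" "e 0 y x = 0" for x y
      using qm that by (auto simp: quasi_metric_def e_simps)
  next
    fix \<sigma> assume \<sigma>: "range \<sigma> \<subseteq> ?S" "\<And>n. sym_cauchy (e n) \<sigma>"
    have "sym_cauchy d \<sigma>" using \<sigma>(2)[of 0] by (simp add: e_simps)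
    then obtain x where x: "x \<in> ?S" "sym_converges d \<sigma> x"
      using bi \<sigma>(1) unfolding bicomplete_iff by meson
    have "sym_converges (e n) \<sigma> x" for n
    proof (cases n)
      case 0
      then show ?thesis using x by (simp add: e_simps)
    next
      case (Suc m)
      show ?thesis
        using cut_hemimetric_converges[OF WS Wb f x \<sigma>(1), of m] \<sigma>(2)[of "Suc m"] Suc
        by (simp add: e_simps)
    qed
    then show "\<exists>x\<in>?S. \<forall>n. sym_converges (e n) \<sigma> x" using x by blast
  qed blast
  \<comment> \<open>A smaller value of \<open>D\<close> would dominate the cut hemimetric of index
    \<open>Suc n\<close>, which is 1 on such pairs.\<close>
  have "(1/2)^Suc n \<le> D x y" if "x \<in> W n" "y \<in> ?S - W n" for n x y
  proof (rule ccontr)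
    assume "\<not> ?thesis"
    moreover from this have "e (Suc n) x y \<le> D x y"
      using that WS by (intro control) auto
    moreover have "e (Suc n) x y = 1" using that by (simp add: e_simps cut_hemimetric_def)
    moreover have "(1/2::real)^Suc n \<le> 1" by (rule power_le_one) auto
    ultimately show False by linarith
  qed
  then have "\<exists>r>0. \<forall>x\<in>W n. \<forall>y\<in>?S - W n. r \<le> D x y" for n
    by (intro exI[of _ "(1/2)^Suc n"]) auto
  then show ?thesis using that D by blast
qed

section \<open>Countable intersections of unions of locally closed sets\<close>

text \<open>Meaningful only for points in some \<open>U k - V k\<close>; elsewhere the value is
  unspecified.\<close>

definition least_index :: "(nat \<Rightarrow> 'a set) \<Rightarrow> (nat \<Rightarrow> 'a set) \<Rightarrow> 'a \<Rightarrow> nat" where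
  "least_index U V x = (LEAST k. x \<in> U k - V k)"

text \<open>Only finitely many open sets are compared, so the targets of a point form a relatively
  open set. In general the relation is not transitive, as a step may lower the least index and so
  relax the next step.\<close>

definition index_step ::
  "'a set \<Rightarrow> (nat \<Rightarrow> 'a set) \<Rightarrow> (nat \<Rightarrow> 'a set) \<Rightarrow> 'a \<Rightarrow> 'a \<Rightarrow> bool" where
  "index_step S U V x y \<longleftrightarrow> x \<in> S \<and> y \<in> S \<and>
     (\<forall>k\<le>least_index U V x. (x \<in> U k \<longrightarrow> y \<in> U k) \<and> (x \<in> V k \<longrightarrow> y \<in> V k))"

lemma least_index_mem: "x \<in> (\<Union>k. U k - V k) \<Longrightarrow> x \<in> U (least_index U V x) - V (least_index U V x)"
  unfolding least_index_def by (rule LeastI_ex) blast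

lemma least_index_le: "x \<in> U k - V k \<Longrightarrow> least_index U V x \<le> k"
  unfolding least_index_def by (rule Least_le)

text \<open>
  A step may lower the least index. But going round a cycle, membership in the sets of index at most
  the minimum over the cycle can only increase, hence is constant.
\<close>
lemma least_index_eq_if_steps_both_ways:
  assumes S: "S \<subseteq> (\<Union>k. U k - V k)" and "x \<in> S" "y \<in> S"
    and R: "(index_step S U V)\<^sup>*\<^sup>* x y" "(index_step S U V)\<^sup>*\<^sup>* y x"
  shows "least_index U V x = least_index U V y"
proof -
  let ?R = "(index_step S U V)\<^sup>*\<^sup>*"
  define Z where "Z z \<longleftrightarrow> z \<in> S \<and> ?R x z \<and> ?R z x" for z
  have "Z x" "Z y" using assms by (auto simp: Z_def)
  obtain p where p: "Z p" "\<And>z. Z z \<Longrightarrow> least_index U V p \<le> least_index U V z"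
    using ex_has_least_nat[of Z x "least_index U V"] \<open>Z x\<close> by blast
  \<comment> \<open>The premises place every intermediate point of the path in \<open>Z\<close>, so
    its least index is at least that of \<open>p\<close> and each step preserves membership up to
    that index.\<close>
  have mono: "\<forall>k\<le>least_index U V p. (a \<in> U k \<longrightarrow> b \<in> U k) \<and> (a \<in> V k \<longrightarrow> b \<in> V k)"
    if "?R a b" "?R x a" "?R b x" for a b
    using that
  proof (induction rule: rtranclp_induct)
    case base
    then show ?case by simp
  next
    case (step b c)
    have "?R b x" using step.hyps(2) step.prems(2) by (rule converse_rtranclp_into_rtranclp)
    moreover have "?R x b" using step.prems(1) step.hyps(1) by (rule rtranclp_trans)
    moreover have "b \<in> S" using step.hyps(2) by (simp add: index_step_def)
    ultimately have "least_index U V p \<le> least_index U V b" by (intro p(2)) (simp add: Z_def)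
    moreover have "\<forall>k\<le>least_index U V p. (a \<in> U k \<longrightarrow> b \<in> U k) \<and> (a \<in> V k \<longrightarrow> b \<in> V k)"
      using step.IH step.prems(1) \<open>?R b x\<close> by blast
    ultimately show ?case using step.hyps(2) unfolding index_step_def by (meson order_trans)
  qed
  have "least_index U V z = least_index U V p" if "Z z" for z
  proof (rule antisym)
    have "?R p z" "?R z p" using that p(1) unfolding Z_def by (meson rtranclp_trans)+
    then have "p \<in> U k \<longleftrightarrow> z \<in> U k" "p \<in> V k \<longleftrightarrow> z \<in> V k" if "k \<le> least_index U V p" for k
      using mono[of p z] mono[of z p] \<open>Z z\<close> p(1) that unfolding Z_def by blast+
    moreover have "p \<in> U (least_index U V p) - V (least_index U V p)"
      using p(1) S by (intro least_index_mem) (auto simp: Z_def)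
    ultimately have "z \<in> U (least_index U V p) - V (least_index U V p)" by blast
    then show "least_index U V z \<le> least_index U V p" by (rule least_index_le)
  qed (rule p(2)[OF that])
  then show ?thesis using \<open>Z x\<close> \<open>Z y\<close> by metis
qed

text \<open>From a reachable \<open>y\<close>, one further step reaches a whole neighbourhood of
  \<open>y\<close>, cut out by the finitely many sets up to its least index that contain
  \<open>y\<close>.\<close>

lemma openin_index_steps:
  assumes "\<And>k. openin X (U k)" "\<And>k. openin X (V k)" "Y \<subseteq> topspace X"
  shows "openin (subtopology X Y) {y \<in> Y. (index_step Y U V)\<^sup>*\<^sup>* x y}"
proof (subst openin_subopen, intro ballI)
  fix y assume y: "y \<in> {y \<in> Y. (index_step Y U V)\<^sup>*\<^sup>* x y}"
  define P where "P k = (if y \<in> U k then U k else topspace X) \<inter> (if y \<in> V k then V k else topspace X)" for k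
  define T where "T = Y \<inter> ((\<Inter>k\<in>{..least_index U V y}. P k) \<inter> topspace X)"
  have "openin X (P k)" for k using assms by (auto simp: P_def)
  then have "openin (subtopology X Y) T"
    unfolding T_def by (intro openin_subtopology_Int2 openin_INT) auto
  moreover have "y \<in> T" using y assms(3) by (auto simp: T_def P_def)
  moreover have "T \<subseteq> {z \<in> Y. (index_step Y U V)\<^sup>*\<^sup>* x z}"
  proof
    fix z assume z: "z \<in> T"
    then have "z \<in> P k" if "k \<le> least_index U V y" for k using that by (auto simp: T_def)
    then have "index_step Y U V y z"
      unfolding index_step_def using y z by (fastforce simp: T_def P_def split: if_splits)
    then show "z \<in> {z \<in> Y. (index_step Y U V)\<^sup>*\<^sup>* x z}" using y z by (auto simp: T_def)
  qed
  ultimately show "\<exists>T. openin (subtopology X Y) T \<and> y \<in> T \<and> T \<subseteq> {y \<in> Y. (index_step Y U V)\<^sup>*\<^sup>* x y}"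
    by blast
qed

definition preorder_hemimetric :: "('a \<Rightarrow> 'a \<Rightarrow> bool) \<Rightarrow> 'a \<Rightarrow> 'a \<Rightarrow> real" where
  "preorder_hemimetric R x y = (if R x y then 0 else 1)"

lemma hemimetric_preorder_hemimetric: "hemimetric S (preorder_hemimetric R\<^sup>*\<^sup>*)"
  by (auto simp: hemimetric_def preorder_hemimetric_def dest: rtranclp_trans)

text \<open>The gap is one-sided, but convergence controls both \<open>d (\<sigma> n) x\<close> and
  \<open>d x (\<sigma> n)\<close>, so a term near the limit can lie neither in \<open>W\<close>
  without it nor outside \<open>W\<close> without it.\<close>

lemma eventually_isolated_iff:
  assumes "range \<sigma> \<subseteq> S" "x \<in> S" "sym_converges d \<sigma> x"
    and "r > 0" "\<And>a b. \<lbrakk>a \<in> W; b \<in> S - W\<rbrakk> \<Longrightarrow> r \<le> d a b"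
  shows "\<forall>\<^sub>F n in sequentially. \<sigma> n \<in> W \<longleftrightarrow> x \<in> W"
proof -
  have "\<forall>\<^sub>F n in sequentially. d (\<sigma> n) x < r \<and> d x (\<sigma> n) < r"
    using assms(3,4) by (simp add: sym_converges_def)
  then show ?thesis
  proof eventually_elim
    case (elim n)
    have "\<sigma> n \<in> S" using assms(1) by blast
    then show ?case using elim assms(5)[of x "\<sigma> n"] assms(5)[of "\<sigma> n" x] assms(2) by auto
  qed
qed

text \<open>Eventually the terms reach each other, so they share one least index \<open>r\<close>,
  and the gaps carry membership in \<open>U r - V r\<close> to the limit. The first conclusion
  concerns limits in \<open>S\<close>, because it serves to put the limit into
  \<open>Y\<close>.\<close>

lemma index_steps_converges:
  assumes UV: "\<And>k. \<exists>r>0. \<forall>a\<in>U k. \<forall>b\<in>S - U k. r \<le> d a b"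
      "\<And>k. \<exists>r>0. \<forall>a\<in>V k. \<forall>b\<in>S - V k. r \<le> d a b"
    and Y: "Y \<subseteq> (\<Union>k. U k - V k)" "Y \<subseteq> S"
    and \<sigma>: "range \<sigma> \<subseteq> Y" "sym_cauchy (preorder_hemimetric (index_step Y U V)\<^sup>*\<^sup>*) \<sigma>"
    and x: "x \<in> S" "sym_converges d \<sigma> x"
  shows "x \<in> (\<Union>k. U k - V k)"
    and "x \<in> Y \<Longrightarrow> sym_converges (preorder_hemimetric (index_step Y U V)\<^sup>*\<^sup>*) \<sigma> x"
proof -
  let ?R = "(index_step Y U V)\<^sup>*\<^sup>*"
  have \<sigma>Y: "\<sigma> n \<in> Y" for n using \<sigma> by auto
  obtain N where "\<And>m n. \<lbrakk>m \<ge> N; n \<ge> N\<rbrakk> \<Longrightarrow> preorder_hemimetric ?R (\<sigma> m) (\<sigma> n) < 1"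
    using \<sigma>(2) unfolding sym_cauchy_def by (meson zero_less_one)
  then have N: "?R (\<sigma> m) (\<sigma> n)" if "m \<ge> N" "n \<ge> N" for m n
    using that by (fastforce simp: preorder_hemimetric_def split: if_splits)
  define r where "r = least_index U V (\<sigma> N)"
  have r: "least_index U V (\<sigma> n) = r" if "n \<ge> N" for n
    unfolding r_def using N that by (intro least_index_eq_if_steps_both_ways[OF Y(1)] \<sigma>Y) auto
  have "\<forall>\<^sub>F n in sequentially. (\<sigma> n \<in> U k \<longleftrightarrow> x \<in> U k) \<and> (\<sigma> n \<in> V k \<longleftrightarrow> x \<in> V k)" for k
  proof (rule eventually_conj)
    have \<sigma>S: "range \<sigma> \<subseteq> S" using \<sigma>(1) Y(2) by blast
    show "\<forall>\<^sub>F n in sequentially. \<sigma> n \<in> U k \<longleftrightarrow> x \<in> U k"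
      using UV(1)[of k] eventually_isolated_iff[OF \<sigma>S x] by meson
    show "\<forall>\<^sub>F n in sequentially. \<sigma> n \<in> V k \<longleftrightarrow> x \<in> V k"
      using UV(2)[of k] eventually_isolated_iff[OF \<sigma>S x] by meson
  qed
  then have "\<forall>\<^sub>F n in sequentially. \<forall>k\<in>{..r}. (\<sigma> n \<in> U k \<longleftrightarrow> x \<in> U k) \<and> (\<sigma> n \<in> V k \<longleftrightarrow> x \<in> V k)"
    by (intro eventually_ball_finite) auto
  then have ev: "\<forall>\<^sub>F n in sequentially. n \<ge> N \<and>
      (\<forall>k\<in>{..r}. (\<sigma> n \<in> U k \<longleftrightarrow> x \<in> U k) \<and> (\<sigma> n \<in> V k \<longleftrightarrow> x \<in> V k))"
    by (intro eventually_conj eventually_ge_at_top)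
  then obtain n where n: "n \<ge> N"
      "\<And>k. k \<le> r \<Longrightarrow> (\<sigma> n \<in> U k \<longleftrightarrow> x \<in> U k) \<and> (\<sigma> n \<in> V k \<longleftrightarrow> x \<in> V k)"
    by (auto simp: eventually_sequentially)
  have "\<sigma> n \<in> U r - V r" using least_index_mem[of "\<sigma> n" U V] r[OF n(1)] \<sigma>Y Y(1) by auto
  then have xr: "x \<in> U r - V r" using n(2) by auto
  then show "x \<in> (\<Union>k. U k - V k)" by blast
  show "sym_converges (preorder_hemimetric ?R) \<sigma> x" if "x \<in> Y"
    unfolding sym_converges_def
  proof (intro allI impI)
    fix e :: real assume "e > 0"
    from ev show "\<forall>\<^sub>F n in sequentially. preorder_hemimetric ?R (\<sigma> n) x < e \<and>
        preorder_hemimetric ?R x (\<sigma> n) < e"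
    proof eventually_elim
      case (elim n)
      \<comment> \<open>The limit and the tail agree on all sets up to \<open>r\<close>, and their
        least indices are at most \<open>r\<close>, so single steps lead both ways.\<close>
      have "least_index U V x \<le> r" using xr by (rule least_index_le)
      then have "index_step Y U V (\<sigma> n) x" "index_step Y U V x (\<sigma> n)"
        using elim r[of n] \<sigma>Y \<open>x \<in> Y\<close> by (auto simp: index_step_def)
      then show ?case using \<open>e > 0\<close> by (simp add: preorder_hemimetric_def r_into_rtranclp)
    qed
  qed
qed

text \<open>A quasi-metric with gaps gives the topology and separates points; the preorder
  hemimetric for each \<open>n\<close> forces limits into the \<open>n\<close>-th union.\<close>

lemma admits_bicomplete_quasi_metric_subtopology:
  fixes U V :: "nat \<Rightarrow> nat \<Rightarrow> 'a set"
  assumes X: "admits_bicomplete_quasi_metric X"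
    and UV: "\<And>n k. openin X (U n k)" "\<And>n k. openin X (V n k)"
    and Y: "Y = topspace X \<inter> (\<Inter>n. \<Union>k. U n k - V n k)"
  shows "admits_bicomplete_quasi_metric (subtopology X Y)"
proof -
  let ?S = "topspace X" and ?T = "subtopology X Y"
  \<comment> \<open>One sequence enumerates both families, so that a single quasi-metric has gaps at
    all their members.\<close>
  define W where "W i = (case from_nat i of (b, n, k) \<Rightarrow> if b then U n k else V n k)" for i :: nat
  have "openin X (W i)" for i using UV by (simp add: W_def split: prod.split)
  then obtain d where qm: "quasi_metric ?S d" and top: "qmetric_topology ?S d = X"
    and bi: "bicomplete ?S d"
    and iso: "\<And>i. \<exists>r>0. \<forall>a\<in>W i. \<forall>b\<in>?S - W i. r \<le> d a b"
    using isolate_open_sets[OF X] by blast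
  have isoU: "\<exists>r>0. \<forall>a\<in>U n k. \<forall>b\<in>?S - U n k. r \<le> d a b" for n k
    using iso[of "to_nat (True, n, k)"] by (simp add: W_def)
  have isoV: "\<exists>r>0. \<forall>a\<in>V n k. \<forall>b\<in>?S - V n k. r \<le> d a b" for n k
    using iso[of "to_nat (False, n, k)"] by (simp add: W_def)
  have hm: "hemimetric ?S d" using qm by (rule quasi_metric_imp_hemimetric)
  have YS: "Y \<subseteq> ?S" and YUV: "Y \<subseteq> (\<Union>k. U n k - V n k)" for n by (auto simp: Y)
  have T: "topspace ?T = Y" using YS by auto
  let ?h = "\<lambda>n. preorder_hemimetric (index_step Y (U n) (V n))\<^sup>*\<^sup>*"
  define e where "e n = (case n of 0 \<Rightarrow> d | Suc m \<Rightarrow> ?h m)" for n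
  have e_simps: "e 0 = d" "e (Suc m) = ?h m" for m
    by (simp_all add: e_def)
  obtain D where "quasi_metric Y D" "qmetric_topology Y D = ?T" "bicomplete Y D"
  proof (rule combine_hemimetrics[of ?T e, unfolded T])
    show "hemimetric Y (e n)" for n
      using hm YS hemimetric_preorder_hemimetric
      by (cases n) (auto simp: e_simps hemimetric_def subset_iff)
  next
    fix n x and r :: real assume x: "x \<in> Y" and r: "r > 0"
    show "\<exists>O'. openin ?T O' \<and> x \<in> O' \<and> O' \<subseteq> qball Y (e n) x r"
    proof (cases n)
      case 0
      have "openin ?T (Y \<inter> qball ?S d x r)"
        using x YS r by (intro openin_subtopology_Int2 openin_qball[OF hm top]) auto
      moreover have "x \<in> Y \<inter> qball ?S d x r"
        using x YS r hemimetricD(2)[OF hm, of x] by (auto simp: qball_def)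
      moreover have "Y \<inter> qball ?S d x r \<subseteq> qball Y (e n) x r"
        by (auto simp: qball_def 0 e_simps)
      ultimately show ?thesis by blast
    next
      case (Suc m)
      let ?O = "{y \<in> Y. (index_step Y (U m) (V m))\<^sup>*\<^sup>* x y}"
      have "openin ?T ?O" by (intro openin_index_steps UV YS)
      moreover have "?O \<subseteq> qball Y (e n) x r"
        using r by (auto simp: qball_def Suc e_simps preorder_hemimetric_def)
      ultimately show ?thesis using x by blast
    qed
  next
    fix O' x assume O': "openin ?T O'" "x \<in> O'"
    then obtain G where G: "openin X G" "O' = G \<inter> Y" by (auto simp: openin_subtopology)
    then obtain r where "r > 0" "qball ?S d x r \<subseteq> G"
      using openin_qmetric_topology[OF hm, unfolded top] O'(2) by blast
    then show "\<exists>r>0. qball Y (e 0) x r \<subseteq> O'"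
      using YS G(2) by (intro exI[of _ r]) (auto simp: qball_def e_simps)
  next
    show "x = y" if "x \<in> Y" "y \<in> Y" "e 0 x y = 0" "e 0 y x = 0" for x y
      using qm that YS unfolding quasi_metric_def e_simps by (meson subsetD)
  next
    fix \<sigma> assume \<sigma>: "range \<sigma> \<subseteq> Y" "\<And>n. sym_cauchy (e n) \<sigma>"
    have "sym_cauchy d \<sigma>" and cauchy: "sym_cauchy (?h n) \<sigma>" for n
      using \<sigma>(2)[of 0] \<sigma>(2)[of "Suc n"] by (simp_all add: e_simps)
    then obtain x where x: "x \<in> ?S" "sym_converges d \<sigma> x"
      using bi \<sigma>(1) YS unfolding bicomplete_iff by (meson order_trans)
    note conv = index_steps_converges[OF isoU isoV YUV YS \<sigma>(1) cauchy x]
    have "x \<in> Y" unfolding Y using x(1) conv(1) by blast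
    have "sym_converges (e n) \<sigma> x" for n
      using x(2) conv(2)[OF \<open>x \<in> Y\<close>] by (cases n) (simp_all add: e_simps)
    then show "\<exists>x\<in>Y. \<forall>n. sym_converges (e n) \<sigma> x" using \<open>x \<in> Y\<close> by blast
  qed blast
  then show ?thesis unfolding admits_bicomplete_quasi_metric_def T by blast
qed

section \<open>The Borel hierarchy up to level three\<close>

lemma borel_sigma_1_iff: "borel_sigma X (Suc 0) A \<longleftrightarrow> openin X A"
  using open_sigma[of X A] by (auto elim: borel_sigma.cases)

lemma borel_sigma_le_2D:
  assumes "borel_sigma X b A" "b < 3"
  obtains U V :: "nat \<Rightarrow> 'a set"
    where "\<And>k. openin X (U k)" "\<And>k. openin X (V k)" "A = (\<Union>k. U k - V k)"
  using assms(1)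
proof cases
  case open_sigma
  then show ?thesis using that[of "\<lambda>_. A" "\<lambda>_. {}"] by auto
next
  case (union_sigma \<beta> B B')
  have "\<beta> i = 1" for i
  proof -
    have "1 \<le> \<beta> i \<and> \<beta> i < b" using union_sigma(3) by blast
    then show ?thesis using assms(2) by linarith
  qed
  then have "openin X (B i)" "openin X (B' i)" for i
    using union_sigma(3) by (simp_all add: borel_sigma_1_iff)
  then show ?thesis using that union_sigma(1) by blast
qed

text \<open>By De Morgan, within \<open>topspace X\<close>, the complement of the union of the
  \<open>B i - B' i\<close> is the intersection over \<open>i\<close> and \<open>k\<close> of
  \<open>(topspace X - U i k) \<union> V i k \<union> B' i\<close>, each a countable union of
  differences of open sets.\<close>

lemma borel_pi_3D:
  assumes "borel_pi X 3 Y"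
  obtains U V :: "nat \<Rightarrow> nat \<Rightarrow> 'a set"
    where "\<And>n k. openin X (U n k)" "\<And>n k. openin X (V n k)"
      "Y = topspace X \<inter> (\<Inter>n. \<Union>k. U n k - V n k)"
proof -
  obtain A where A: "borel_sigma X 3 A" "Y = topspace X - A"
    using assms by (auto simp: borel_pi_def)
  have "\<exists>\<beta> B B'. A = (\<Union>i::nat. B i - B' i) \<and>
      (\<forall>i. \<beta> i < 3 \<and> borel_sigma X (\<beta> i) (B i) \<and> borel_sigma X (\<beta> i) (B' i))"
    using A(1)
  proof cases
    case (union_sigma \<beta> B B')
    then show ?thesis by (intro exI[of _ \<beta>] exI[of _ B] exI[of _ B']) simp
  qed simp
  then obtain \<beta> B B' where B: "A = (\<Union>i::nat. B i - B' i)" "\<And>i. \<beta> i < 3"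
      "\<And>i. borel_sigma X (\<beta> i) (B i)" "\<And>i. borel_sigma X (\<beta> i) (B' i)"
    by blast
  have "\<exists>U V. (\<forall>k. openin X (U k)) \<and> (\<forall>k. openin X (V k)) \<and> B i = (\<Union>k::nat. U k - V k)" for i
    using borel_sigma_le_2D[OF B(3,2), of i] by metis
  then obtain U V where UV: "\<And>i k. openin X (U i k)" "\<And>i k. openin X (V i k)"
      "\<And>i. B i = (\<Union>k::nat. U i k - V i k)"
    by metis
  have "\<exists>U V. (\<forall>k. openin X (U k)) \<and> (\<forall>k. openin X (V k)) \<and> B' i = (\<Union>k::nat. U k - V k)" for i
    using borel_sigma_le_2D[OF B(4,2), of i] by metis
  then obtain U' V' where UV': "\<And>i k. openin X (U' i k)" "\<And>i k. openin X (V' i k)"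
      "\<And>i. B' i = (\<Union>k::nat. U' i k - V' i k)"
    by metis
  \<comment> \<open>\<open>n\<close> codes the pair \<open>(i, k)\<close>. Index 0 gives
    \<open>topspace X - U i k\<close>, index 1 gives \<open>V i k\<close>, and the indices from 2 on
    give the pieces of \<open>B' i\<close>.\<close>
  define P where "P n l = (case prod_decode n of (i, k) \<Rightarrow>
      case l of 0 \<Rightarrow> topspace X | Suc 0 \<Rightarrow> V i k | Suc (Suc m) \<Rightarrow> U' i m)" for n l
  define Q where "Q n l = (case prod_decode n of (i, k) \<Rightarrow>
      case l of 0 \<Rightarrow> U i k | Suc 0 \<Rightarrow> {} | Suc (Suc m) \<Rightarrow> V' i m)" for n l
  have PQ: "(\<Union>l. P (prod_encode (i, k)) l - Q (prod_encode (i, k)) l) =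
      (topspace X - U i k) \<union> V i k \<union> B' i" (is "?L = ?R") for i k
  proof
    show "?L \<subseteq> ?R"
      by (auto simp: P_def Q_def UV'(3) split: nat.splits)
    have "topspace X - U i k = P (prod_encode (i, k)) 0 - Q (prod_encode (i, k)) 0"
      "V i k = P (prod_encode (i, k)) 1 - Q (prod_encode (i, k)) 1"
      "\<And>m. U' i m - V' i m = P (prod_encode (i, k)) (Suc (Suc m)) - Q (prod_encode (i, k)) (Suc (Suc m))"
      by (simp_all add: P_def Q_def)
    then show "?R \<subseteq> ?L" unfolding UV'(3) by blast
  qed
  show ?thesis
  proof
    show "openin X (P n l)" "openin X (Q n l)" for n l
      using UV UV' by (auto simp: P_def Q_def split: prod.split nat.split)
    have "(\<Inter>n. \<Union>l. P n l - Q n l) = (\<Inter>i. \<Inter>k. (topspace X - U i k) \<union> V i k \<union> B' i)"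
    proof -
      have "(\<Inter>n. F n) = (\<Inter>i. \<Inter>k. F (prod_encode (i, k)))" for F :: "nat \<Rightarrow> 'a set"
        by auto (metis prod_decode_inverse surj_pair)
      then show ?thesis unfolding PQ[symmetric] .
    qed
    then show "Y = topspace X \<inter> (\<Inter>n. \<Union>l. P n l - Q n l)"
      unfolding A(2) B(1) UV(3) by auto
  qed
qed

section \<open>Sigma sets of levels two and three from countable unions\<close>

lemma borel_sigma_countable_Union:
  assumes "countable F" "1 < a" "1 \<le> b" "b < a" "borel_sigma X b {}"
    and "\<And>G. G \<in> F \<Longrightarrow> \<exists>P Q. borel_sigma X b P \<and> borel_sigma X b Q \<and> G = P - Q"
  shows "borel_sigma X a (\<Union>F)"
proof -
  have "\<exists>P Q. borel_sigma X b P \<and> borel_sigma X b Q \<and> G = P - Q" if "G \<in> insert {} F" for G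
    using assms(5,6) that by (cases "G = {}") blast+
  then obtain P Q where PQ: "\<And>G. G \<in> insert {} F \<Longrightarrow>
      borel_sigma X b (P G) \<and> borel_sigma X b (Q G) \<and> G = P G - Q G"
    by metis
  \<comment> \<open>Adding the empty set leaves the union unchanged and provides an enumeration even
    for empty \<open>F\<close>.\<close>
  let ?g = "from_nat_into (insert {} F)"
  have rg: "range ?g = insert {} F"
    using assms(1) by (intro range_from_nat_into) auto
  then have g: "?g i \<in> insert {} F" for i by blast
  have "borel_sigma X a (\<Union>i::nat. P (?g i) - Q (?g i))"
    using PQ[OF g] assms(2,3,4) by (intro union_sigma[where \<beta> = "\<lambda>_. b"]) auto
  moreover have "(\<Union>i::nat. P (?g i) - Q (?g i)) = \<Union>(range ?g)"
    using PQ[OF g] by auto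
  ultimately show ?thesis by (simp add: rg)
qed

lemma borel_sigma_2_Union:
  assumes "countable F" and "\<And>G. G \<in> F \<Longrightarrow> \<exists>P Q. openin X P \<and> openin X Q \<and> G = P - Q"
  shows "borel_sigma X 2 (\<Union>F)"
  using assms
  by (intro borel_sigma_countable_Union[where b = "Suc 0"]) (simp_all add: borel_sigma_1_iff)

lemma openin_imp_borel_sigma_2: "openin X U \<Longrightarrow> borel_sigma X 2 U"
  using borel_sigma_2_Union[of "{U}" X] by (force intro: exI[of _ "{}"])

lemma borel_sigma_3_Union:
  assumes "countable F"
    and "\<And>G. G \<in> F \<Longrightarrow> \<exists>P Q. borel_sigma X 2 P \<and> borel_sigma X 2 Q \<and> G = P - Q"
  shows "borel_sigma X 3 (\<Union>F)"
  using assms openin_imp_borel_sigma_2[OF openin_empty]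
  by (intro borel_sigma_countable_Union[where b = 2]) auto

section \<open>Bicompletely quasi-metrizable subspaces\<close>

text \<open>
  The topology, not the symmetrization, is second countable. Points sharing a basic neighbourhood
  contained in both of their \<open>r\<close>-balls are \<open>r\<close>-close in both directions, which gives separability
  of the symmetrization.
\<close>
lemma second_countable_imp_sym_separable:
  assumes "second_countable Z" and hm: "hemimetric (topspace Z) d"
    and top: "qmetric_topology (topspace Z) d = Z"
  obtains D where "countable D" "D \<subseteq> topspace Z"
    "\<And>y r. \<lbrakk>y \<in> topspace Z; r > 0\<rbrakk> \<Longrightarrow> \<exists>a\<in>D. d a y < r \<and> d y a < r"
proof -
  let ?S = "topspace Z"
  obtain B where B: "countable B" "\<And>U x. \<lbrakk>openin Z U; x \<in> U\<rbrakk> \<Longrightarrow> \<exists>V\<in>B. x \<in> V \<and> V \<subseteq> U"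
    using assms(1) unfolding second_countable_def by meson
  \<comment> \<open>Points of the same \<open>A W n\<close> lie in \<open>W\<close>, hence in each
    other's balls, so one point from each nonempty \<open>A W n\<close> is enough.\<close>
  define A where "A W n = {y \<in> ?S. y \<in> W \<and> W \<subseteq> qball ?S d y (inverse (real (Suc n)))}" for W n
  define D where "D = (\<lambda>(W, n). SOME a. a \<in> A W n) ` {(W, n). W \<in> B \<and> A W n \<noteq> {}}"
  have some: "(SOME a. a \<in> A W n) \<in> A W n" if "A W n \<noteq> {}" for W n
    using that by (simp add: some_in_eq)
  show ?thesis
  proof
    have "countable {(W, n). W \<in> B \<and> A W n \<noteq> {}}"
      by (rule countable_subset[of _ "B \<times> (UNIV :: nat set)"]) (use B(1) in auto)
    then show "countable D" unfolding D_def by (rule countable_image)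
    show "D \<subseteq> ?S" using some by (auto simp: D_def A_def)
  next
    fix y and r :: real assume y: "y \<in> ?S" "r > 0"
    obtain n where n: "inverse (real (Suc n)) < r" using reals_Archimedean y(2) by blast
    let ?b = "qball ?S d y (inverse (real (Suc n)))"
    have "openin Z ?b" using y by (intro openin_qball[OF hm top]) auto
    moreover have "y \<in> ?b" using y hemimetricD(2)[OF hm] by (simp add: qball_def)
    ultimately obtain W where W: "W \<in> B" "y \<in> W" "W \<subseteq> ?b" using B(2) by meson
    then have yA: "y \<in> A W n" using y by (simp add: A_def)
    define a where "a = (SOME a. a \<in> A W n)"
    have aA: "a \<in> A W n" unfolding a_def using some yA by blast
    have "a \<in> D" unfolding D_def a_def using W(1) yA by (intro image_eqI[of _ _ "(W, n)"]) auto
    have close: "d u v < r" if "u \<in> A W n" "v \<in> A W n" for u v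
      using that n by (fastforce simp: A_def qball_def)
    show "\<exists>a\<in>D. d a y < r \<and> d y a < r"
      by (rule bexI[OF _ \<open>a \<in> D\<close>]) (simp only: close[OF aA yA] close[OF yA aA] simp_thms)
  qed
qed

text \<open>The largest open set of \<open>X\<close> whose trace on \<open>Y\<close> lies in
  \<open>G\<close>; this carries distance conditions over to points outside
  \<open>Y\<close>.\<close>

definition open_extension :: "'a topology \<Rightarrow> 'a set \<Rightarrow> 'a set \<Rightarrow> 'a set" where
  "open_extension X Y G = \<Union>{U. openin X U \<and> U \<inter> Y \<subseteq> G}"

lemma openin_open_extension: "openin X (open_extension X Y G)"
  unfolding open_extension_def by (rule openin_Union) auto

lemma open_extension_Int:
  assumes "openin (subtopology X Y) G"
  shows "open_extension X Y G \<inter> Y = G"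
proof
  show "open_extension X Y G \<inter> Y \<subseteq> G" by (auto simp: open_extension_def)
  obtain U where "openin X U" "G = U \<inter> Y" using assms by (auto simp: openin_subtopology)
  then show "G \<subseteq> open_extension X Y G \<inter> Y" by (auto simp: open_extension_def)
qed

text \<open>
  A point \<open>x\<close> satisfying the three conditions below is the limit of the Cauchy sequence of centres
  provided by the first one: the second condition supplies points of \<open>Y\<close> that witness all the
  distance estimates, and the third one makes basic neighbourhoods of \<open>x\<close> survive the limit.
\<close>
lemma borel_pi_3_if_bicomplete_subspace:
  assumes sc: "second_countable X"
    and T0: "\<And>x y. \<lbrakk>x \<in> topspace X; y \<in> topspace X; \<And>U. openin X U \<Longrightarrow> x \<in> U \<longleftrightarrow> y \<in> U\<rbrakk> \<Longrightarrow> x = y"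
    and YS: "Y \<subseteq> topspace X"
    and ad: "admits_bicomplete_quasi_metric (subtopology X Y)"
  shows "borel_pi X 3 Y"
proof -
  let ?Z = "subtopology X Y" and ?r = "\<lambda>n. inverse (real (Suc n))"
  have TZ: "topspace ?Z = Y" using YS by auto
  obtain d where qm: "quasi_metric Y d" and top: "qmetric_topology Y d = ?Z" and bi: "bicomplete Y d"
    using ad unfolding admits_bicomplete_quasi_metric_def TZ by blast
  have hm: "hemimetric Y d" using qm by (rule quasi_metric_imp_hemimetric)
  note tri = hemimetricD(3)[OF hm]
  note op = openin_qmetric_topology[OF hm, unfolded top]
  have "second_countable ?Z" using sc by (rule second_countable_subtopology)
  then obtain D where D: "countable D" "D \<subseteq> Y"
      "\<And>y r. \<lbrakk>y \<in> Y; r > 0\<rbrakk> \<Longrightarrow> \<exists>a\<in>D. d a y < r \<and> d y a < r"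
    using second_countable_imp_sym_separable[of ?Z d, unfolded TZ, OF _ hm top] by blast
  obtain \<B> where \<B>: "countable \<B>" "\<And>B. B \<in> \<B> \<Longrightarrow> openin X B"
      "\<And>U x. \<lbrakk>openin X U; x \<in> U\<rbrakk> \<Longrightarrow> \<exists>B\<in>\<B>. x \<in> B \<and> B \<subseteq> U"
    using sc unfolding second_countable_def by meson
  \<comment> \<open>The strict inequalities in \<open>far\<close> and \<open>core\<close> make these
    sets relatively open. The difference of \<open>ball\<close> and \<open>far\<close> is a
    symmetric ball, non-strict in one direction.\<close>
  define ball where "ball a n = qball Y d a (?r n)" for a n
  define far where "far a n = {y \<in> Y. ?r n < d y a}" for a n
  define core where "core B n = {y \<in> Y. \<exists>e>?r n. qball Y d y e \<subseteq> B}" for B n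
  define U where "U a n = open_extension X Y (ball a n)" for a n
  define V where "V a n = open_extension X Y (far a n)" for a n
  define I where "I B n = open_extension X Y (core B n)" for B n
  have open_UVI: "openin X (U a n)" "openin X (V a n)" "openin X (I B n)" for a n B
    by (simp_all add: U_def V_def I_def openin_open_extension)
  have UY: "y \<in> U a n \<longleftrightarrow> d a y < ?r n" if "y \<in> Y" "a \<in> Y" for y a n
  proof -
    have "openin ?Z (ball a n)"
      unfolding ball_def using openin_qball[of ?Z d a "?r n", unfolded TZ, OF hm top that(2)] by simp
    from open_extension_Int[OF this] show ?thesis
      using that by (auto simp: U_def ball_def qball_def)
  qed
  have VY: "y \<in> V a n \<longleftrightarrow> ?r n < d y a" if "y \<in> Y" "a \<in> Y" for y a n
  proof -
    have "openin ?Z (far a n)"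
      unfolding op
    proof (intro conjI ballI)
      fix z assume z: "z \<in> far a n"
      have "qball Y d z (d z a - ?r n) \<subseteq> far a n"
        using z tri[of z _ a] that(2) by (fastforce simp: far_def qball_def)
      then show "\<exists>e>0. qball Y d z e \<subseteq> far a n"
        using z by (intro exI[of _ "d z a - ?r n"]) (simp add: far_def)
    qed (auto simp: far_def)
    from open_extension_Int[OF this] show ?thesis
      using that by (auto simp: V_def far_def)
  qed
  have IY: "y \<in> I B n \<longleftrightarrow> (\<exists>e>?r n. qball Y d y e \<subseteq> B)" if "y \<in> Y" for y B n
  proof -
    have "openin ?Z (core B n)"
      unfolding op
    proof (intro conjI ballI)
      fix z assume "z \<in> core B n"
      then obtain e where z: "z \<in> Y" and e: "e > ?r n" "qball Y d z e \<subseteq> B"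
        by (auto simp: core_def)
      have "w \<in> core B n" if w: "w \<in> Y" "d z w < e - ?r n" for w
      proof -
        have "qball Y d w (e - d z w) \<subseteq> qball Y d z e"
          using tri[of z w] z w(1) by (fastforce simp: qball_def)
        then have "qball Y d w (e - d z w) \<subseteq> B" "e - d z w > ?r n" using e(2) w(2) by auto
        then show ?thesis unfolding core_def using w(1) by blast
      qed
      then show "\<exists>s>0. qball Y d z s \<subseteq> core B n"
        using e(1) by (intro exI[of _ "e - ?r n"]) (auto simp: qball_def)
    qed (auto simp: core_def)
    from open_extension_Int[OF this] show ?thesis
      using that by (auto simp: I_def core_def)
  qed
  define \<O> where "\<O> = \<B> \<union> (\<lambda>(a, n). U a n) ` (D \<times> UNIV) \<union> (\<lambda>(a, n). V a n) ` (D \<times> UNIV)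
      \<union> (\<lambda>(B, n). I B n) ` (\<B> \<times> UNIV)"
  have \<O>: "countable \<O>" "\<And>W. W \<in> \<O> \<Longrightarrow> openin X W"
    using D(1) \<B>(1,2) open_UVI by (auto simp: \<O>_def)
  have in_\<O>: "B \<in> \<B> \<Longrightarrow> B \<in> \<O>" "a \<in> D \<Longrightarrow> U a n \<in> \<O>" "a \<in> D \<Longrightarrow> V a n \<in> \<O>"
      "B \<in> \<B> \<Longrightarrow> I B n \<in> \<O>" for a n B
    by (force simp: \<O>_def)+

  \<comment> \<open>Two sets on each side in \<open>c2\<close> are enough to impose two symmetric
    ball conditions at once.\<close>
  have limit_point: "x \<in> Y"
    if x: "x \<in> topspace X"
      and c1: "\<And>n. \<exists>a\<in>D. x \<in> U a n - V a n"
      and c2: "\<And>A B C E. \<lbrakk>A \<in> \<O>; B \<in> \<O>; C \<in> \<O>; E \<in> \<O>; x \<in> A \<inter> B - (C \<union> E)\<rbrakk>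
          \<Longrightarrow> \<exists>y\<in>Y. y \<in> A \<inter> B - (C \<union> E)"
      and c3: "\<And>B. \<lbrakk>B \<in> \<B>; x \<in> B\<rbrakk> \<Longrightarrow> \<exists>n. x \<in> I B n" for x
  proof -
    obtain a where a: "\<And>n. a n \<in> D" "\<And>n. x \<in> U (a n) n - V (a n) n"
      using c1 by metis
    have aY: "a n \<in> Y" for n using a(1) D(2) by blast
    have near: "d (a n) z < ?r n" "d z (a n) \<le> ?r n" if "z \<in> Y" "z \<in> U (a n) n - V (a n) n" for z n
      using UY[OF that(1) aY, of n n] VY[OF that(1) aY, of n n] that(2) by auto
    have small: "\<exists>N. \<forall>n\<ge>N. ?r n < e" if "e > 0" for e :: real
    proof -
      obtain N where "?r N < e" using reals_Archimedean \<open>e > 0\<close> by blast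
      moreover have "?r n \<le> ?r N" if "n \<ge> N" for n using that by (simp add: le_imp_inverse_le)
      ultimately show ?thesis by (meson le_less_trans)
    qed
    \<comment> \<open>As \<open>x\<close> may lie outside \<open>Y\<close>, where \<open>d\<close>
      carries no information, a point \<open>z\<close> of \<open>Y\<close> satisfying both ball
      conditions takes its place.\<close>
    have dist_a: "d (a m) (a n) < ?r m + ?r n + ?r n" for m n
    proof -
      obtain z where z: "z \<in> Y" "z \<in> U (a m) m \<inter> U (a n) n - (V (a m) m \<union> V (a n) n)"
        using c2[of "U (a m) m" "U (a n) n" "V (a m) m" "V (a n) n"] in_\<O> a by blast
      then have "d (a m) z < ?r m" "d z (a n) \<le> ?r n" using near[of z m] near[of z n] by auto
      moreover have "d (a m) (a n) \<le> d (a m) z + d z (a n)" using tri aY z(1) by blast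
      moreover have "?r n > 0" by simp
      ultimately show ?thesis by linarith
    qed
    have "sym_cauchy d a"
      unfolding sym_cauchy_def
    proof (intro allI impI)
      fix e :: real assume "e > 0"
      then obtain N where N: "\<And>n. n \<ge> N \<Longrightarrow> ?r n < e/3" using small[of "e/3"] by auto
      have "d (a m) (a n) < e" if "m \<ge> N" "n \<ge> N" for m n
        using dist_a[of m n] N[OF that(1)] N[OF that(2)] by linarith
      then show "\<exists>N. \<forall>m\<ge>N. \<forall>n\<ge>N. d (a m) (a n) < e" by blast
    qed
    moreover have "range a \<subseteq> Y" using aY by blast
    ultimately obtain y where y: "y \<in> Y" "sym_converges d a y"
      using bi unfolding bicomplete_iff by meson
    have close: "\<exists>n. \<forall>z\<in>Y. z \<in> U (a n) n - V (a n) n \<longrightarrow> d y z < e \<and> d z y < e" if "e > 0" for e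
    proof -
      obtain N where N: "\<And>n. n \<ge> N \<Longrightarrow> ?r n < e/2" using small[of "e/2"] \<open>e > 0\<close> by auto
      obtain M where M: "\<And>n. n \<ge> M \<Longrightarrow> d (a n) y < e/2 \<and> d y (a n) < e/2"
        using y(2) \<open>e > 0\<close> unfolding sym_converges_def eventually_sequentially by (meson half_gt_zero)
      define n where "n = max M N"
      have "d y z < e \<and> d z y < e" if z: "z \<in> Y" "z \<in> U (a n) n - V (a n) n" for z
        using near[OF z] N[of n] M[of n] tri[OF y(1) aY z(1), of n] tri[OF z(1) aY y(1), of n]
        by (auto simp: n_def)
      then show ?thesis by blast
    qed
    have "x \<in> B \<longleftrightarrow> y \<in> B" if B: "B \<in> \<B>" for B
    proof
      assume "y \<in> B"
      have "openin ?Z (B \<inter> Y)" using \<B>(2)[OF B] by (rule openin_subtopology_Int)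
      then obtain e where e: "e > 0" "qball Y d y e \<subseteq> B \<inter> Y"
        using op \<open>y \<in> B\<close> y(1) by blast
      obtain n where n: "\<And>z. \<lbrakk>z \<in> Y; z \<in> U (a n) n - V (a n) n\<rbrakk> \<Longrightarrow> d y z < e"
        using close[OF e(1)] by blast
      show "x \<in> B"
      proof (rule ccontr)
        assume "x \<notin> B"
        then obtain z where z: "z \<in> Y" "z \<in> U (a n) n \<inter> U (a n) n - (V (a n) n \<union> B)"
          using c2[of "U (a n) n" "U (a n) n" "V (a n) n" B] in_\<O> a B by blast
        then have "z \<in> qball Y d y e" using n[of z] by (auto simp: qball_def)
        then show False using z(2) e(2) by blast
      qed
    next
      assume "x \<in> B"
      \<comment> \<open>The radius is fixed before \<open>z\<close> is chosen: a point
        \<open>z\<close> of \<open>Y\<close> in \<open>I B k\<close> has a ball of radius above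
        \<open>?r k\<close> inside \<open>B\<close>, so \<open>d z y < ?r k\<close> puts
        \<open>y\<close> into \<open>B\<close>.\<close>
      then obtain k where k: "x \<in> I B k" using c3 B by blast
      have "?r k > 0" by simp
      then obtain n where n: "\<And>z. \<lbrakk>z \<in> Y; z \<in> U (a n) n - V (a n) n\<rbrakk> \<Longrightarrow> d z y < ?r k"
        using close[of "?r k"] by blast
      obtain z where z: "z \<in> Y" "z \<in> I B k \<inter> U (a n) n - (V (a n) n \<union> V (a n) n)"
        using c2[of "I B k" "U (a n) n" "V (a n) n" "V (a n) n"] in_\<O> a B k by blast
      then obtain e where "e > ?r k" "qball Y d z e \<subseteq> B" using IY[OF z(1)] by blast
      then show "y \<in> B" using n[of z] z y(1) by (auto simp: qball_def)
    qed
    then have "x \<in> G \<longleftrightarrow> y \<in> G" if "openin X G" for G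
      using \<B>(3)[OF that] by (meson subsetD)
    then have "x = y" using T0 x y(1) YS by blast
    then show ?thesis using y(1) by simp
  qed

  \<comment> \<open>The three families collect the violations of the three conditions of
    \<open>limit_point\<close>; together they cover exactly the complement of
    \<open>Y\<close>.\<close>
  define F1 where "F1 = range (\<lambda>n. topspace X - (\<Union>a\<in>D. U a n - V a n))"
  define F2 where "F2 = (\<lambda>(A, B, C, E). A \<inter> B - (C \<union> E)) `
      {(A, B, C, E) \<in> \<O> \<times> \<O> \<times> \<O> \<times> \<O>. Y \<inter> (A \<inter> B - (C \<union> E)) = {}}"
  define F3 where "F3 = (\<lambda>B. B - (\<Union>n. I B n)) ` \<B>"
  have "borel_sigma X 3 (\<Union>(F1 \<union> F2 \<union> F3))"
  proof (rule borel_sigma_3_Union)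
    have "countable {(A, B, C, E) \<in> \<O> \<times> \<O> \<times> \<O> \<times> \<O>. Y \<inter> (A \<inter> B - (C \<union> E)) = {}}"
      by (rule countable_subset[of _ "\<O> \<times> \<O> \<times> \<O> \<times> \<O>"]) (use \<O>(1) in auto)
    then show "countable (F1 \<union> F2 \<union> F3)"
      using \<B>(1) by (auto simp: F1_def F2_def F3_def)
  next
    fix G assume "G \<in> F1 \<union> F2 \<union> F3"
    then consider "G \<in> F1" | "G \<in> F2" | "G \<in> F3" by blast
    then show "\<exists>P Q. borel_sigma X 2 P \<and> borel_sigma X 2 Q \<and> G = P - Q"
    proof cases
      case 1
      then obtain n where "G = topspace X - (\<Union>a\<in>D. U a n - V a n)" by (auto simp: F1_def)
      moreover have "borel_sigma X 2 (\<Union>a\<in>D. U a n - V a n)"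
        using D(1) open_UVI(1,2) by (intro borel_sigma_2_Union) (auto, metis)
      ultimately show ?thesis using openin_imp_borel_sigma_2[OF openin_topspace] by blast
    next
      case 2
      then obtain A B C E where "A \<in> \<O>" "B \<in> \<O>" "C \<in> \<O>" "E \<in> \<O>" "G = A \<inter> B - (C \<union> E)"
        by (auto simp: F2_def)
      moreover from this have "borel_sigma X 2 (A \<inter> B)" "borel_sigma X 2 (C \<union> E)"
        using \<O>(2) by (auto intro!: openin_imp_borel_sigma_2)
      ultimately show ?thesis by blast
    next
      case 3
      then obtain B where "B \<in> \<B>" "G = B - (\<Union>n. I B n)" by (auto simp: F3_def)
      moreover from this have "borel_sigma X 2 B" "borel_sigma X 2 (\<Union>n. I B n)"
        using \<B>(2) open_UVI by (auto intro!: openin_imp_borel_sigma_2)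
      ultimately show ?thesis by blast
    qed
  qed
  moreover have "Y = topspace X - \<Union>(F1 \<union> F2 \<union> F3)"
  proof (intro set_eqI iffI)
    fix y assume y: "y \<in> Y"
    have "y \<notin> G" if GF: "G \<in> F1" for G
    proof -
      obtain n where n: "G = topspace X - (\<Union>a\<in>D. U a n - V a n)" using GF by (auto simp: F1_def)
      have "?r n > 0" by simp
      then obtain a where a: "a \<in> D" "d a y < ?r n" "d y a < ?r n" using D(3)[OF y] by blast
      then have "y \<in> U a n - V a n" using UY[OF y, of a n] VY[OF y, of a n] D(2) by auto
      then show ?thesis using n a(1) by blast
    qed
    moreover have "y \<notin> G" if "G \<in> F2" for G
      using that y by (auto simp: F2_def)
    moreover have "y \<notin> G" if GF: "G \<in> F3" for G
    proof
      assume "y \<in> G"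
      then obtain B where B: "B \<in> \<B>" "y \<in> B" "y \<notin> (\<Union>n. I B n)" using GF by (auto simp: F3_def)
      have "openin ?Z (B \<inter> Y)" using \<B>(2)[OF B(1)] by (rule openin_subtopology_Int)
      then obtain e where e: "e > 0" "qball Y d y e \<subseteq> B \<inter> Y" using op B(2) y by blast
      obtain n where "?r n < e" using reals_Archimedean e(1) by blast
      then have "y \<in> I B n" using IY[OF y] e(2) by blast
      then show False using B(3) by blast
    qed
    ultimately show "y \<in> topspace X - \<Union>(F1 \<union> F2 \<union> F3)" using y YS by blast
  next
    fix x assume x: "x \<in> topspace X - \<Union>(F1 \<union> F2 \<union> F3)"
    show "x \<in> Y"
    proof (rule limit_point)
      show "x \<in> topspace X" using x by blast
    next
      fix n
      have "topspace X - (\<Union>a\<in>D. U a n - V a n) \<in> F1" by (simp add: F1_def)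
      then show "\<exists>a\<in>D. x \<in> U a n - V a n" using x by blast
    next
      fix A B C E assume "A \<in> \<O>" "B \<in> \<O>" "C \<in> \<O>" "E \<in> \<O>" and xm: "x \<in> A \<inter> B - (C \<union> E)"
      then have "A \<inter> B - (C \<union> E) \<in> F2" if "Y \<inter> (A \<inter> B - (C \<union> E)) = {}"
        unfolding F2_def using that by (intro image_eqI[of _ _ "(A, B, C, E)"]) auto
      then show "\<exists>y\<in>Y. y \<in> A \<inter> B - (C \<union> E)" using x xm by blast
    next
      fix B assume "B \<in> \<B>" "x \<in> B"
      then have "B - (\<Union>n. I B n) \<in> F3" by (simp add: F3_def)
      then show "\<exists>n. x \<in> I B n" using x \<open>x \<in> B\<close> by blast
    qed
  qed
  ultimately show ?thesis unfolding borel_pi_def by blast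
qed

theorem theorem32:
  fixes X :: "'a topology" and Y :: "'a set"
  assumes "second_countable X"
    and "admits_bicomplete_quasi_metric X"
    and "Y \<subseteq> topspace X"
  shows "admits_bicomplete_quasi_metric (subtopology X Y) \<longleftrightarrow> borel_pi X 3 Y"
proof
  assume ad: "admits_bicomplete_quasi_metric (subtopology X Y)"
  obtain d where qm: "quasi_metric (topspace X) d" and top: "qmetric_topology (topspace X) d = X"
    using assms(2) by (auto simp: admits_bicomplete_quasi_metric_def)
  note hm = quasi_metric_imp_hemimetric[OF qm]
  \<comment> \<open>A quasi-metric topology is T0: points in the same open sets lie in all balls
    about each other, so both distances vanish.\<close>
  have zero: "d x y = 0"
    if xy: "x \<in> topspace X" "y \<in> topspace X" and iff: "\<And>U. openin X U \<Longrightarrow> x \<in> U \<longleftrightarrow> y \<in> U" for x y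
  proof (rule antisym)
    show "d x y \<le> 0"
    proof (rule field_le_epsilon)
      fix e :: real assume "e > 0"
      then have "openin X (qball (topspace X) d x e)" using openin_qball[OF hm top xy(1)] by blast
      moreover have "x \<in> qball (topspace X) d x e"
        using xy(1) \<open>e > 0\<close> hemimetricD(2)[OF hm] by (simp add: qball_def)
      ultimately have "y \<in> qball (topspace X) d x e" using iff by blast
      then show "d x y \<le> 0 + e" by (simp add: qball_def)
    qed
  qed (rule hemimetricD(1)[OF hm xy])
  show "borel_pi X 3 Y"
  proof (rule borel_pi_3_if_bicomplete_subspace[OF assms(1) _ assms(3) ad])
    fix x y assume "x \<in> topspace X" "y \<in> topspace X" "\<And>U. openin X U \<Longrightarrow> x \<in> U \<longleftrightarrow> y \<in> U"
    then have "d x y = 0" "d y x = 0" using zero by blast+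
    then show "x = y"
      using qm \<open>x \<in> topspace X\<close> \<open>y \<in> topspace X\<close> unfolding quasi_metric_def by meson
  qed
next
  assume "borel_pi X 3 Y"
  then show "admits_bicomplete_quasi_metric (subtopology X Y)"
    by (rule borel_pi_3D) (rule admits_bicomplete_quasi_metric_subtopology[OF assms(2)])
qed

end
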